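(* Suppose that the positive integers $n=n(N)$ satisfy $n/N\to\gamma\in(0,1)$ as $N\to\infty$, and set $\phi_\gamma=\arccos(1-2\gamma)$. Then, for every fixed $A,B\in\mathbb Z$, $$\lim_{N\to\infty}\mathfrak K^{(0)}_{n,\mathrm{Kr}}(A,B)=\eta(A)\eta(B)\left[\mathbb K_{\sin,\phi_\gamma}(A,B)+\mathbb K_{\sin,\phi_\gamma}(-A,B)\right],$$ $$\lim_{N\to\infty}\mathfrak K^{(1)}_{n,\mathrm{Kr}}(A,B)=\mathbb K_{\sin,\phi_\gamma}(A,B)-\mathbb K_{\sin,\phi_\gamma}(-A,B).$$
   Context: Let $\mathfrak X=\{-N,\dots,N\}$ and let $w(x)=\binom{2N}{N+x}2^{-2N}$, $x\in\mathfrak X$, be the symmetric Krawtchouk weight. $P_m$ ($0\le m\le 2N$) are the monic orthogonal polynomials on $\mathfrak X$ with respect to $w$, with norms $h_m>0$, $h_m^2=\sum_xP_m(x)^2w(x)$, and $p_m(x)=P_m(x)\sqrt{w(x)}/h_m$. $\hat P_m$ ($0\le m\le2N-1$) are the monic orthogonal polynomials on $\mathfrak X$ with respect to $x^{2}w(x)$, with norms $\hat h_m>0$ in that weight, and $\hat p_m(x)=\hat P_m(x)\,x\sqrt{w(x)}/\hat h_m$. Put $\eta(x)=1$ for $x\ne0$, $\eta(0)=1/\sqrt2$. For $x,y\in\mathfrak X$, $$\mathfrak K^{(0)}_{n,\mathrm{Kr}}(x,y)=2\eta(x)\eta(y)\sum_{\ell=0}^{n-1}p_{2\ell}(x)p_{2\ell}(y),\qquad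 \mathfrak K^{(1)}_{n,\mathrm{Kr}}(x,y)=2\sum_{\ell=0}^{n-1}\hat p_{2\ell}(x)\hat p_{2\ell}(y).$$ For $\phi\in[0,\pi]$ the discrete sine kernel on $\mathbb Z^2$ is $\mathbb K_{\sin,\phi}(A,B)=\dfrac{\sin(\phi(A-B))}{\pi(A-B)}$ for $A\ne B$ and $\mathbb K_{\sin,\phi}(A,A)=\phi/\pi$. *)

theory Defs
  imports Complex_Main "HOL-Computational_Algebra.Polynomial"
begin

definition weighted_inner :: "int set \<Rightarrow> (int \<Rightarrow> real) \<Rightarrow> real poly \<Rightarrow> real poly \<Rightarrow> real" where
  "weighted_inner X w P Q = (\<Sum>x\<in>X. poly P (of_int x) * poly Q (of_int x) * w x)"

definition is_monic_orthogonal ::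
  "int set \<Rightarrow> (int \<Rightarrow> real) \<Rightarrow> nat \<Rightarrow> real poly \<Rightarrow> bool" where
  "is_monic_orthogonal X w m P \<longleftrightarrow>
     degree P = m \<and> lead_coeff P = 1 \<and>
     (\<forall>Q. degree Q < m \<longrightarrow> weighted_inner X w P Q = 0)"

text \<open>Well defined as long as \<open>m\<close> does not exceed the number of points of positive weight,
  see \<open>ex1_is_monic_orthogonal\<close> below.\<close>

definition monic_orthogonal_poly :: "int set \<Rightarrow> (int \<Rightarrow> real) \<Rightarrow> nat \<Rightarrow> real poly" where
  "monic_orthogonal_poly X w m = (THE P. is_monic_orthogonal X w m P)"

definition orthogonal_poly_norm :: "int set \<Rightarrow> (int \<Rightarrow> real) \<Rightarrow> nat \<Rightarrow> real" where
  "orthogonal_poly_norm X w m =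
     sqrt (weighted_inner X w (monic_orthogonal_poly X w m) (monic_orthogonal_poly X w m))"

definition kr_space :: "nat \<Rightarrow> int set" where
  "kr_space N = {- int N..int N}"

text \<open>The following functions of \<open>x\<close> are meaningful only for \<open>x \<in> kr_space N\<close>; in particular
  \<open>nat (int N + x)\<close> truncates below \<open>- N\<close>.\<close>

definition kr_weight :: "nat \<Rightarrow> int \<Rightarrow> real" where
  "kr_weight N x = real ((2 * N) choose nat (int N + x)) / 2 ^ (2 * N)"

definition kr_weight_hat :: "nat \<Rightarrow> int \<Rightarrow> real" where
  "kr_weight_hat N x = (of_int x)\<^sup>2 * kr_weight N x"

definition kr_p :: "nat \<Rightarrow> nat \<Rightarrow> int \<Rightarrow> real" where
  "kr_p N m x =
     poly (monic_orthogonal_poly (kr_space N) (kr_weight N) m) (of_int x) * sqrt (kr_weight N x)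
       / orthogonal_poly_norm (kr_space N) (kr_weight N) m"

text \<open>The factor \<open>x\<close> is signed: \<open>x * sqrt (w x)\<close> differs from \<open>sqrt (x\<^sup>2 * w x)\<close> for negative \<open>x\<close>.\<close>

definition kr_p_hat :: "nat \<Rightarrow> nat \<Rightarrow> int \<Rightarrow> real" where
  "kr_p_hat N m x =
     poly (monic_orthogonal_poly (kr_space N) (kr_weight_hat N) m) (of_int x)
       * of_int x * sqrt (kr_weight N x)
       / orthogonal_poly_norm (kr_space N) (kr_weight_hat N) m"

definition eta :: "int \<Rightarrow> real" where
  "eta x = (if x = 0 then 1 / sqrt 2 else 1)"

definition kr_kernel0 :: "nat \<Rightarrow> nat \<Rightarrow> int \<Rightarrow> int \<Rightarrow> real" where
  "kr_kernel0 N n x y = 2 * eta x * eta y * (\<Sum>l<n. kr_p N (2 * l) x * kr_p N (2 * l) y)"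

definition kr_kernel1 :: "nat \<Rightarrow> nat \<Rightarrow> int \<Rightarrow> int \<Rightarrow> real" where
  "kr_kernel1 N n x y = 2 * (\<Sum>l<n. kr_p_hat N (2 * l) x * kr_p_hat N (2 * l) y)"

definition sine_kernel :: "real \<Rightarrow> int \<Rightarrow> int \<Rightarrow> real" where
  "sine_kernel \<phi> A B =
     (if A = B then \<phi> / pi
      else sin (\<phi> * of_int (A - B)) / (pi * of_int (A - B)))"

lemma weighted_inner_commute: "weighted_inner X w P Q = weighted_inner X w Q P"
  by (simp add: weighted_inner_def mult.commute)

lemma weighted_inner_add_left:
  "weighted_inner X w (P + P') Q = weighted_inner X w P Q + weighted_inner X w P' Q"
  by (simp add: weighted_inner_def algebra_simps sum.distrib)

lemma weighted_inner_diff_left: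
  "weighted_inner X w (P - P') Q = weighted_inner X w P Q - weighted_inner X w P' Q"
  by (simp add: weighted_inner_def algebra_simps sum_subtractf)

lemma weighted_inner_smult_left:
  "weighted_inner X w (smult c P) Q = c * weighted_inner X w P Q"
  by (simp add: weighted_inner_def sum_distrib_left mult.assoc)

lemma weighted_inner_add_right:
  "weighted_inner X w P (Q + Q') = weighted_inner X w P Q + weighted_inner X w P Q'"
  using weighted_inner_add_left weighted_inner_commute by metis

lemma weighted_inner_smult_right:
  "weighted_inner X w P (smult c Q) = c * weighted_inner X w P Q"
  using weighted_inner_smult_left weighted_inner_commute by metis

lemma weighted_inner_self_eq_0:
  assumes "finite X" and nonneg: "\<And>x. x \<in> X \<Longrightarrow> w x \<ge> 0"
    and deg: "degree P < card {x \<in> X. w x > 0}"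
    and eq: "weighted_inner X w P P = 0"
  shows "P = 0"
proof (rule ccontr)
  assume "P \<noteq> 0"
  let ?S = "{x \<in> X. w x > 0}"
  have "\<forall>x\<in>X. poly P (of_int x) * poly P (of_int x) * w x = 0"
    using eq \<open>finite X\<close> nonneg unfolding weighted_inner_def
    by (subst (asm) sum_nonneg_eq_0_iff) auto
  then have sub: "(of_int ` ?S :: real set) \<subseteq> {x. poly P x = 0}" by auto
  have "card ?S = card (of_int ` ?S :: real set)"
    by (rule card_image [symmetric]) (simp add: inj_on_def)
  also have "\<dots> \<le> card {x. poly P x = 0}"
    using sub \<open>P \<noteq> 0\<close> by (intro card_mono poly_roots_finite)
  also have "\<dots> \<le> degree P" using \<open>P \<noteq> 0\<close> by (rule card_poly_roots_bound)
  finally show False using deg by simp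
qed

lemma ex_orthogonal_projection:
  assumes "finite X" and nonneg: "\<And>x. x \<in> X \<Longrightarrow> w x \<ge> 0"
    and "m \<le> card {x \<in> X. w x > 0}"
  shows "\<exists>R. (\<forall>i\<ge>m. coeff R i = 0) \<and>
    (\<forall>Q. (\<forall>i\<ge>m. coeff Q i = 0) \<longrightarrow> weighted_inner X w (F - R) Q = 0)"
  using assms(3)
proof (induction m arbitrary: F)
  case 0
  have "Q = 0" if "\<forall>i\<ge>0. coeff Q i = 0" for Q :: "real poly"
    using that by (simp add: poly_eq_iff)
  then have "\<forall>Q. (\<forall>i\<ge>0. coeff Q i = 0) \<longrightarrow> weighted_inner X w (F - 0) Q = 0"
    by (metis weighted_inner_smult_right smult_0_left mult_zero_left)
  then show ?case by (intro exI[of _ 0]) simp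
next
  case (Suc m)
  obtain R where R: "\<forall>i\<ge>m. coeff R i = 0"
    "\<And>Q. \<forall>i\<ge>m. coeff Q i = 0 \<Longrightarrow> weighted_inner X w (F - R) Q = 0"
    using Suc.IH[of F] Suc.prems by auto
  obtain S where S: "\<forall>i\<ge>m. coeff S i = 0"
    "\<And>Q. \<forall>i\<ge>m. coeff Q i = 0 \<Longrightarrow> weighted_inner X w (monom 1 m - S) Q = 0"
    using Suc.IH[of "monom 1 m"] Suc.prems by auto
  define P where "P = monom 1 m - S"
  have P_m: "coeff P m = 1" using S(1) by (simp add: P_def)
  have P_gt: "coeff P i = 0" if "i > m" for i using S(1) that by (simp add: P_def)
  have "degree P \<le> m" using P_gt by (intro degree_le) auto
  moreover have "P \<noteq> 0" using P_m by auto
  ultimately have PP: "weighted_inner X w P P \<noteq> 0"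
    using weighted_inner_self_eq_0[of X w P] assms(1) nonneg Suc.prems by fastforce
  define c where "c = weighted_inner X w (F - R) P / weighted_inner X w P P"
  have "weighted_inner X w (F - (R + smult c P)) Q = 0" if Q: "\<forall>i\<ge>Suc m. coeff Q i = 0" for Q
  proof -
    define Q' where "Q' = Q - smult (coeff Q m) P"
    have Q': "\<forall>i\<ge>m. coeff Q' i = 0"
    proof (intro allI impI)
      fix i assume "m \<le> i"
      then show "coeff Q' i = 0"
        using P_m P_gt Q by (cases "i = m") (auto simp: Q'_def)
    qed
    have Q_eq: "Q = Q' + smult (coeff Q m) P" by (simp add: Q'_def)
    have F_eq: "F - (R + smult c P) = (F - R) - smult c P" by simp
    have "weighted_inner X w P Q' = 0" using S(2)[OF Q'] by (simp add: P_def)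
    moreover have "weighted_inner X w (F - R) Q' = 0" using R(2)[OF Q'] .
    moreover have "weighted_inner X w (F - R - smult c P) P = 0"
      using PP by (simp only: weighted_inner_diff_left weighted_inner_smult_left c_def) simp
    ultimately show ?thesis
      unfolding F_eq
      by (subst Q_eq) (simp add: weighted_inner_add_right weighted_inner_smult_right
          weighted_inner_diff_left weighted_inner_smult_left)
  qed
  moreover have "\<forall>i\<ge>Suc m. coeff (R + smult c P) i = 0" using R(1) P_gt by auto
  ultimately show ?case by blast
qed

lemma ex1_is_monic_orthogonal:
  assumes "finite X" and nonneg: "\<And>x. x \<in> X \<Longrightarrow> w x \<ge> 0"
    and m: "m \<le> card {x \<in> X. w x > 0}"
  shows "\<exists>!P. is_monic_orthogonal X w m P"
proof (rule ex_ex1I)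
  obtain S where S: "\<forall>i\<ge>m. coeff S i = 0"
    "\<And>Q. \<forall>i\<ge>m. coeff Q i = 0 \<Longrightarrow> weighted_inner X w (monom 1 m - S) Q = 0"
    using ex_orthogonal_projection[of X w m "monom 1 m"] assms by metis
  define P where "P = monom 1 m - S"
  have P_m: "coeff P m = 1" using S(1) by (simp add: P_def)
  have "degree P \<le> m" using S(1) by (intro degree_le) (auto simp: P_def)
  moreover have "m \<le> degree P" using P_m by (intro le_degree) simp
  ultimately have "degree P = m" by simp
  moreover have "weighted_inner X w P Q = 0" if "degree Q < m" for Q
    unfolding P_def using that by (intro S(2)) (auto intro: coeff_eq_0)
  ultimately show "\<exists>P. is_monic_orthogonal X w m P"
    using P_m unfolding is_monic_orthogonal_def by auto
next
  fix P P' assume P: "is_monic_orthogonal X w m P" and P': "is_monic_orthogonal X w m P'"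
  show "P = P'"
  proof (cases "m = 0")
    case True
    then have "degree P = 0" "degree P' = 0" "coeff P 0 = coeff P' 0"
      using P P' by (auto simp: is_monic_orthogonal_def)
    then show ?thesis by (metis degree_eq_zeroE coeff_pCons_0)
  next
    case False
    have coeff: "coeff (P - P') i = 0" if "i \<ge> m" for i
      using P P' that by (cases "i = m") (auto simp: is_monic_orthogonal_def coeff_eq_0)
    have "degree (P - P') \<le> m - 1" using coeff False by (intro degree_le) auto
    then have deg: "degree (P - P') < m" using False by simp
    then have "weighted_inner X w (P - P') (P - P') = 0"
      using P P' by (simp add: is_monic_orthogonal_def weighted_inner_diff_left)
    then have "P - P' = 0"
      using weighted_inner_self_eq_0[of X w "P - P'"] assms deg by fastforce
    then show ?thesis by simp
  qed
qed

lemma kr_weight_pos: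
  assumes "x \<in> kr_space N"
  shows "kr_weight N x > 0"
proof -
  have "nat (int N + x) \<le> 2 * N" using assms by (simp add: kr_space_def nat_le_iff)
  then show ?thesis by (simp add: kr_weight_def)
qed

lemma ex1_is_monic_orthogonal_kr:
  assumes "m \<le> 2 * N"
  shows "\<exists>!P. is_monic_orthogonal (kr_space N) (kr_weight N) m P"
proof (rule ex1_is_monic_orthogonal)
  have "{x \<in> kr_space N. kr_weight N x > 0} = kr_space N" using kr_weight_pos by blast
  then show "m \<le> card {x \<in> kr_space N. kr_weight N x > 0}"
    using assms by (simp add: kr_space_def)
qed (use kr_weight_pos in \<open>auto simp: kr_space_def intro: less_imp_le\<close>)

lemma ex1_is_monic_orthogonal_kr_hat:
  assumes "m \<le> 2 * N - 1"
  shows "\<exists>!P. is_monic_orthogonal (kr_space N) (kr_weight_hat N) m P"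
proof (rule ex1_is_monic_orthogonal)
  have "{x \<in> kr_space N. kr_weight_hat N x > 0} = kr_space N - {0}"
    using kr_weight_pos by (auto simp: kr_weight_hat_def)
  then show "m \<le> card {x \<in> kr_space N. kr_weight_hat N x > 0}"
    using assms by (simp add: kr_space_def card_Diff_subset)
  show "kr_weight_hat N x \<ge> 0" if "x \<in> kr_space N" for x
    using kr_weight_pos[OF that] by (simp add: kr_weight_hat_def)
qed (simp add: kr_space_def)

end

theory Submission imports Defs "HOL-Analysis.Analysis" begin

text \<open>Both kernels come from the Christoffel-Darboux kernel
  \<open>K (x, y) = (\<Sum>m<2*n. p\<^sub>m x * p\<^sub>m y)\<close>. The weight is even, so \<open>p\<^sub>m\<close> has the parity of
  \<open>m\<close>; moreover \<open>x\<close> times the monic orthogonal polynomial of degree \<open>2 * l\<close> for the weight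
  \<open>x\<^sup>2 * w\<close> is the one of degree \<open>2 * l + 1\<close> for \<open>w\<close>. Hence the kernels are
  \<open>\<eta> x * \<eta> y * (K (x, y) + K (- x, y))\<close> and \<open>K (x, y) - K (- x, y)\<close>
  (\<open>kr_kernel0_eq\<close>, \<open>kr_kernel1_eq\<close>), and it suffices that \<open>K\<close> tends to the sine kernel.

  For this, \<open>K\<close> is read as a spectral projection. The \<open>p\<^sub>m\<close> are an orthonormal eigenbasis of a
  symmetric Jacobi matrix with eigenvalues \<open>N - m\<close> (\<open>kr_p_complete\<close>, \<open>kr_p_recurrence\<close>). Divided
  by \<open>N\<close>, this matrix tends entrywise, near any fixed lattice point, to half the sum of the two
  shifts of the integer lattice, which is multiplication by \<open>cos t\<close> in the Fourier variable. So the
  moments of the spectral measures, that is of the weights \<open>p\<^sub>m x * p\<^sub>m y\<close> at the points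
  \<open>1 - m / N = cos t\<close>, tend to those of \<open>cos ((x - y) * t) / pi\<close> on \<open>{0..pi}\<close>
  (\<open>kr_moment_limit\<close>). By the Weierstrass theorem the same holds for continuous test functions
  (\<open>kr_angle_limit\<close>). The condition \<open>m < 2 * n\<close> cuts out the angles below
  \<open>arccos (1 - 2 * n / N)\<close>, which tends to \<open>\<phi>\<close>; as the limit measure has a bounded density, a
  sandwich argument gives the limit \<open>(1 / pi)\<close> times the integral of \<open>cos ((x - y) * t)\<close> over
  \<open>{0..\<phi>}\<close> (\<open>kr_kernel_limit\<close>), which is the sine kernel.\<close>

section \<open>Orthonormality and completeness\<close>

text \<open>The Gram kernel \<open>S x y = (\<Sum>i\<in>I. f i x * f i y)\<close> is a projection, so the squared
  norm of its defect against the point mass at \<open>y\<close> is \<open>1 - S y y\<close>. Summed over \<open>y\<close> these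
  defects give \<open>card X - card I = 0\<close>; being nonnegative, they all vanish.\<close>

lemma orthonormal_imp_complete:
  fixes f :: "'i \<Rightarrow> 'x \<Rightarrow> real"
  assumes "finite I" "finite X" "card I = card X"
    and orth: "\<And>i j. i \<in> I \<Longrightarrow> j \<in> I \<Longrightarrow> (\<Sum>x\<in>X. f i x * f j x) = of_bool (i = j)"
    and "x \<in> X" "y \<in> X"
  shows "(\<Sum>i\<in>I. f i x * f i y) = of_bool (x = y)"
proof -
  define S where "S x y = (\<Sum>i\<in>I. f i x * f i y)" for x y
  define r where "r x y = of_bool (x = y) - S x y" for x y
  have SS: "(\<Sum>x\<in>X. (S x y)\<^sup>2) = S y y" for y
  proof -
    have "(\<Sum>x\<in>X. (S x y)\<^sup>2) = (\<Sum>x\<in>X. \<Sum>i\<in>I. \<Sum>j\<in>I. (f i x * f j x) * (f i y * f j y))"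
      by (simp add: S_def power2_eq_square sum_product mult_ac)
    also have "\<dots> = (\<Sum>i\<in>I. \<Sum>x\<in>X. \<Sum>j\<in>I. (f i x * f j x) * (f i y * f j y))"
      by (rule sum.swap)
    also have "\<dots> = (\<Sum>i\<in>I. \<Sum>j\<in>I. \<Sum>x\<in>X. (f i x * f j x) * (f i y * f j y))"
      by (intro sum.cong refl sum.swap)
    also have "\<dots> = (\<Sum>i\<in>I. \<Sum>j\<in>I. if i = j then f i y * f j y else 0)"
      by (intro sum.cong refl) (simp add: sum_distrib_right [symmetric] orth)
    also have "\<dots> = S y y"
      using \<open>finite I\<close> by (simp add: S_def)
    finally show ?thesis .
  qed
  have "(\<Sum>x\<in>X. (r x y)\<^sup>2) = 1 - S y y" if "y \<in> X" for y
  proof -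
    have "(r x y)\<^sup>2 = (if x = y then 1 - 2 * S x y else 0) + (S x y)\<^sup>2" for x
      by (simp add: r_def power2_eq_square algebra_simps)
    then have "(\<Sum>x\<in>X. (r x y)\<^sup>2) = (\<Sum>x\<in>X. if x = y then 1 - 2 * S x y else 0) + S y y"
      by (simp add: sum.distrib SS)
    also have "(\<Sum>x\<in>X. if x = y then 1 - 2 * S x y else 0) = 1 - 2 * S y y"
      using \<open>finite X\<close> that by simp
    finally show ?thesis by simp
  qed
  then have "(\<Sum>y\<in>X. \<Sum>x\<in>X. (r x y)\<^sup>2) = real (card X) - (\<Sum>y\<in>X. S y y)"
    by (simp add: sum_subtractf)
  also have "(\<Sum>y\<in>X. S y y) = (\<Sum>i\<in>I. \<Sum>y\<in>X. f i y * f i y)"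
    unfolding S_def by (rule sum.swap)
  also have "\<dots> = real (card X)"
    using assms(3) by (simp add: orth)
  finally have "(\<Sum>y\<in>X. \<Sum>x\<in>X. (r x y)\<^sup>2) = 0" by simp
  then have "\<forall>y\<in>X. (\<Sum>x\<in>X. (r x y)\<^sup>2) = 0"
    using \<open>finite X\<close> by (subst (asm) sum_nonneg_eq_0_iff) (auto intro: sum_nonneg)
  then have "(\<Sum>x\<in>X. (r x y)\<^sup>2) = 0" using \<open>y \<in> X\<close> by blast
  then have "r x y = 0"
    using \<open>finite X\<close> \<open>x \<in> X\<close> by (subst (asm) sum_nonneg_eq_0_iff) auto
  then show ?thesis by (simp add: r_def S_def)
qed

lemma is_monic_orthogonal_kr:
  assumes "m \<le> 2 * N"
  shows "is_monic_orthogonal (kr_space N) (kr_weight N) m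
    (monic_orthogonal_poly (kr_space N) (kr_weight N) m)"
  unfolding monic_orthogonal_poly_def by (rule theI', rule ex1_is_monic_orthogonal_kr, fact)

lemma is_monic_orthogonal_kr_hat:
  assumes "m \<le> 2 * N - 1"
  shows "is_monic_orthogonal (kr_space N) (kr_weight_hat N) m
    (monic_orthogonal_poly (kr_space N) (kr_weight_hat N) m)"
  unfolding monic_orthogonal_poly_def by (rule theI', rule ex1_is_monic_orthogonal_kr_hat, fact)

lemma kr_inner_self_eq_0:
  assumes "degree P \<le> 2 * N" "weighted_inner (kr_space N) (kr_weight N) P P = 0"
  shows "P = 0"
proof (rule weighted_inner_self_eq_0)
  have "{x \<in> kr_space N. kr_weight N x > 0} = kr_space N" using kr_weight_pos by blast
  then show "degree P < card {x \<in> kr_space N. kr_weight N x > 0}"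
    using assms by (simp add: kr_space_def)
qed (use assms kr_weight_pos in \<open>auto simp: kr_space_def intro: less_imp_le\<close>)

lemma kr_poly_inner_pos:
  assumes "is_monic_orthogonal (kr_space N) (kr_weight N) m P" "m \<le> 2 * N"
  shows "weighted_inner (kr_space N) (kr_weight N) P P > 0"
proof -
  have "weighted_inner (kr_space N) (kr_weight N) P P \<ge> 0"
    unfolding weighted_inner_def
    by (intro sum_nonneg) (simp add: kr_weight_pos less_imp_le)
  moreover have "weighted_inner (kr_space N) (kr_weight N) P P \<noteq> 0"
  proof
    assume "weighted_inner (kr_space N) (kr_weight N) P P = 0"
    then have "P = 0"
      using assms by (intro kr_inner_self_eq_0) (auto simp: is_monic_orthogonal_def)
    then show False using assms by (simp add: is_monic_orthogonal_def)
  qed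
  ultimately show ?thesis by simp
qed

lemma kr_p_orthonormal:
  assumes "i \<le> 2 * N" "j \<le> 2 * N"
  shows "(\<Sum>x\<in>kr_space N. kr_p N i x * kr_p N j x) = of_bool (i = j)"
proof -
  let ?P = "monic_orthogonal_poly (kr_space N) (kr_weight N)"
  let ?h = "orthogonal_poly_norm (kr_space N) (kr_weight N)"
  have "(\<Sum>x\<in>kr_space N. kr_p N i x * kr_p N j x) =
      weighted_inner (kr_space N) (kr_weight N) (?P i) (?P j) / (?h i * ?h j)"
    unfolding weighted_inner_def sum_divide_distrib
  proof (rule sum.cong[OF refl])
    fix x assume "x \<in> kr_space N"
    then have "sqrt (kr_weight N x) * sqrt (kr_weight N x) = kr_weight N x"
      using kr_weight_pos[of x N] by simp
    then have "kr_p N i x * kr_p N j x = poly (?P i) (of_int x) * poly (?P j) (of_int x) *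
         (sqrt (kr_weight N x) * sqrt (kr_weight N x)) / (?h i * ?h j)"
      unfolding kr_p_def by (simp add: field_simps)
    then show "kr_p N i x * kr_p N j x =
        poly (?P i) (of_int x) * poly (?P j) (of_int x) * kr_weight N x / (?h i * ?h j)"
      using \<open>_ = kr_weight N x\<close> by simp
  qed
  also have "\<dots> = of_bool (i = j)"
  proof (cases i j rule: linorder_cases)
    case equal
    then show ?thesis
      using kr_poly_inner_pos[OF is_monic_orthogonal_kr assms(1)] assms
      by (simp add: orthogonal_poly_norm_def)
  next
    case less
    then have "weighted_inner (kr_space N) (kr_weight N) (?P j) (?P i) = 0"
      using is_monic_orthogonal_kr[OF assms(1)] is_monic_orthogonal_kr[OF assms(2)]
      by (auto simp: is_monic_orthogonal_def)
    then show ?thesis using less by (simp add: weighted_inner_commute)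
  next
    case greater
    then have "weighted_inner (kr_space N) (kr_weight N) (?P i) (?P j) = 0"
      using is_monic_orthogonal_kr[OF assms(1)] is_monic_orthogonal_kr[OF assms(2)]
      by (auto simp: is_monic_orthogonal_def)
    then show ?thesis using greater by simp
  qed
  finally show ?thesis .
qed

text \<open>This is the normalization of the spectral measures: the sum of all weights
  \<open>kr_p N m x * kr_p N m y\<close> is their moment of order \<open>0\<close>.\<close>

lemma kr_p_complete:
  assumes "x \<in> kr_space N" "y \<in> kr_space N"
  shows "(\<Sum>m\<le>2*N. kr_p N m x * kr_p N m y) = of_bool (x = y)"
  by (rule orthonormal_imp_complete[where X = "kr_space N"])
     (use assms kr_p_orthonormal in \<open>auto simp: kr_space_def\<close>)

section \<open>The difference operator of the Krawtchouk polynomials\<close>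

text \<open>The discrete Pearson equation of the binomial weight. It makes the difference operator
  below symmetric, and it turns that operator into a symmetric Jacobi matrix after conjugation by
  the square root of the weight.\<close>

lemma kr_weight_pearson:
  assumes "x \<in> kr_space N"
  shows "(real N - of_int x) * kr_weight N x = (real N + of_int x + 1) * kr_weight N (x + 1)"
proof -
  define k where "k = nat (int N + x)"
  have k: "k \<le> 2 * N" "of_int x = real k - real N" "nat (int N + (x + 1)) = Suc k"
    using assms by (auto simp: k_def kr_space_def nat_le_iff)
  have "(2 * N - k) * (2 * N choose k) = Suc k * (2 * N choose Suc k)"
    using binomial_absorb_comp[of "2*N" k] binomial_absorption[of k "2 * N"] by simp
  then have "real (2 * N - k) * real (2 * N choose k) = (1 + real k) * real (2 * N choose Suc k)"
    by (metis of_nat_mult of_nat_Suc)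
  then show ?thesis
    unfolding kr_weight_def k k_def[symmetric] using k(1) by (simp add: of_nat_diff)
qed

lemma kr_weight_reflect:
  assumes "x \<in> kr_space N"
  shows "kr_weight N (- x) = kr_weight N x"
proof -
  have "nat (int N - x) = 2 * N - nat (int N + x)" "nat (int N + x) \<le> 2 * N"
    using assms by (auto simp: kr_space_def)
  then show ?thesis by (simp add: kr_weight_def binomial_symmetric[symmetric])
qed

text \<open>The second-order difference operator whose eigenfunctions are the Krawtchouk polynomials.
  It acts on polynomials, not on lattice functions, because its eigenvalues come from its effect on
  degrees.\<close>

definition kr_operator :: "nat \<Rightarrow> real poly \<Rightarrow> real poly" where
  "kr_operator N P = smult (1/2) ([:real N, -1:] * pcompose P [:1, 1:]
     + [:real N, 1:] * pcompose P [:-1, 1:])"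

text \<open>The commutator of \<open>kr_operator N\<close> with multiplication by \<open>x\<close>. The commutator of
  \<open>kr_operator_comm N\<close> with \<open>x\<close> is \<open>kr_operator N\<close> again, so the two operators can be computed
  together by recursion on the coefficients.\<close>

definition kr_operator_comm :: "nat \<Rightarrow> real poly \<Rightarrow> real poly" where
  "kr_operator_comm N P = smult (1/2) ([:real N, -1:] * pcompose P [:1, 1:]
     - [:real N, 1:] * pcompose P [:-1, 1:])"

text \<open>The operator is triangular with respect to the degree, with diagonal entries \<open>N - m\<close>;
  these are the eigenvalues. The claim on the commutator is what makes the induction on the
  coefficient list close: passing from \<open>P\<close> to \<open>x * P\<close> lowers the diagonal entry by \<open>1\<close>
  because the leading term of the commutator is \<open>- x * P\<close>.\<close>

lemma kr_operator_coeffs: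
  assumes "degree P \<le> m" "m \<le> i"
  shows "coeff (kr_operator N P) i = (real N - real m) * coeff P i \<and>
         coeff (kr_operator_comm N P) (Suc i) = - coeff P i"
  using assms
proof (induction P arbitrary: m i)
  case 0
  then show ?case by (simp add: kr_operator_def kr_operator_comm_def)
next
  case (pCons a P)
  have D: "kr_operator N (pCons a P) =
      [:a * real N:] + pCons 0 (kr_operator N P) + kr_operator_comm N P"
    by (simp add: kr_operator_def kr_operator_comm_def pcompose_pCons algebra_simps
        smult_add_right smult_diff_right)
  have E: "kr_operator_comm N (pCons a P) =
      [:0, - a:] + pCons 0 (kr_operator_comm N P) + kr_operator N P"
    by (simp add: kr_operator_def kr_operator_comm_def pcompose_pCons algebra_simps
        smult_add_right smult_diff_right)
  show ?case
  proof (cases "P = 0")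
    case True
    then show ?thesis using pCons.prems pCons.hyps unfolding D E
      by (cases i) (auto simp: kr_operator_def kr_operator_comm_def split: nat.splits)
  next
    case False
    then obtain m' where m: "m = Suc m'" "degree P \<le> m'"
      using pCons.prems by (cases m) auto
    then obtain i' where i: "i = Suc i'" "m' \<le> i'"
      using pCons.prems by (cases i) auto
    have "coeff P (Suc (Suc i')) = 0" "coeff P (Suc i') = 0"
      using m i by (auto intro: coeff_eq_0)
    then show ?thesis
      using pCons.IH[OF m(2) i(2)] pCons.IH[of m' "Suc (Suc i')"] pCons.IH[of m' "Suc i'"] m i
      unfolding D E by (simp add: algebra_simps)
  qed
qed

lemma poly_kr_operator:
  "poly (kr_operator N P) x =
     ((real N - x) * poly P (x + 1) + (real N + x) * poly P (x - 1)) / 2"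
  by (simp add: kr_operator_def poly_pcompose algebra_simps add_divide_distrib diff_divide_distrib)

text \<open>The two halves of the operator are adjoint to each other: the shift \<open>x \<mapsto> x + 1\<close> carries
  one into the other by the Pearson equation, and the boundary terms at \<open>x = N\<close> and \<open>x = - N\<close>
  have coefficient zero.\<close>

lemma kr_operator_self_adjoint:
  "weighted_inner (kr_space N) (kr_weight N) (kr_operator N P) Q =
   weighted_inner (kr_space N) (kr_weight N) P (kr_operator N Q)"
proof -
  define hop where "hop P Q = (\<Sum>x\<in>kr_space N.
    (real N - of_int x) * kr_weight N x * poly P (of_int x + 1) * poly Q (of_int x))" for P Q
  have hop': "(\<Sum>x\<in>kr_space N.
      (real N + of_int x) * kr_weight N x * poly P (of_int x - 1) * poly Q (of_int x)) = hop Q P"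
    for P Q
  proof -
    have "hop Q P = (\<Sum>x = - int N..int N - 1.
      (real N - of_int x) * kr_weight N x * poly Q (of_int x + 1) * poly P (of_int x))"
      unfolding hop_def by (rule sum.mono_neutral_right) (auto simp: kr_space_def)
    also have "\<dots> = (\<Sum>x = - int N..int N - 1.
      (real N + of_int x + 1) * kr_weight N (x + 1) * poly Q (of_int x + 1) * poly P (of_int x))"
      by (intro sum.cong refl) (subst kr_weight_pearson, auto simp: kr_space_def)
    also have "\<dots> = (\<Sum>x = - int N + 1..int N.
      (real N + of_int x) * kr_weight N x * poly Q (of_int x) * poly P (of_int x - 1))"
      by (rule sum.reindex_bij_witness[of _ "\<lambda>x. x - 1" "\<lambda>x. x + 1"])
         (auto simp: algebra_simps)
    also have "\<dots> = (\<Sum>x\<in>kr_space N.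
      (real N + of_int x) * kr_weight N x * poly Q (of_int x) * poly P (of_int x - 1))"
    proof (rule sum.mono_neutral_left)
      show "\<forall>x\<in>kr_space N - {- int N + 1..int N}.
       (real N + of_int x) * kr_weight N x * poly Q (of_int x) * poly P (of_int x - 1) = 0"
      proof
        fix x assume "x \<in> kr_space N - {- int N + 1..int N}"
        then have "x = - int N" by (auto simp: kr_space_def)
        then show "(real N + of_int x) * kr_weight N x * poly Q (of_int x) * poly P (of_int x - 1) = 0"
          by simp
      qed
    qed (auto simp: kr_space_def)
    finally show ?thesis by (simp add: mult_ac)
  qed
  have *: "weighted_inner (kr_space N) (kr_weight N) (kr_operator N P) Q = (hop P Q + hop Q P) / 2"
    for P Q
    unfolding hop'[symmetric, of Q P] unfolding hop_def weighted_inner_def poly_kr_operator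
    by (simp add: sum.distrib[symmetric] sum_divide_distrib algebra_simps add_divide_distrib
        diff_divide_distrib)
  show ?thesis
    using *[of P Q] *[of Q P] by (simp add: weighted_inner_commute)
qed

text \<open>Triangularity makes \<open>R = kr_operator N P - (N - m) * P\<close> a polynomial of degree below
  \<open>m\<close>, and self-adjointness makes it orthogonal to all such polynomials, hence to itself.\<close>

lemma kr_operator_eigen:
  assumes P: "is_monic_orthogonal (kr_space N) (kr_weight N) m P" and "m \<le> 2 * N"
  shows "kr_operator N P = smult (real N - real m) P"
proof (cases "m = 0")
  case True
  then obtain c where "P = [:c:]" using P by (auto simp: is_monic_orthogonal_def elim: degree_eq_zeroE)
  then show ?thesis using True by (simp add: kr_operator_def)
next
  case False
  let ?wi = "weighted_inner (kr_space N) (kr_weight N)"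
  have degP: "degree P = m" using P by (simp add: is_monic_orthogonal_def)
  define R where "R = kr_operator N P - smult (real N - real m) P"
  have deg: "degree (kr_operator N Q) \<le> degree Q" for Q
    using kr_operator_coeffs[of Q "degree Q"]
    by (intro degree_le) (auto simp: coeff_eq_0)
  have "coeff R i = 0" if "i \<ge> m" for i
    using kr_operator_coeffs[of P m i N] degP that by (simp add: R_def)
  then have "degree R \<le> m - 1" using False by (intro degree_le) auto
  then have degR: "degree R < m" using False by simp
  have "?wi P (kr_operator N R) = 0" "?wi P R = 0"
    using P degR deg[of R] by (auto simp: is_monic_orthogonal_def)
  then have "?wi R R = 0"
    by (simp add: R_def[symmetric] kr_operator_self_adjoint[symmetric])
       (simp only: R_def weighted_inner_diff_left weighted_inner_smult_left kr_operator_self_adjoint)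
  then have "R = 0"
    using degR assms(2) by (intro kr_inner_self_eq_0) auto
  then show ?thesis by (simp add: R_def)
qed


text \<open>The off-diagonal entries of the Jacobi matrix that \<open>kr_operator N\<close> becomes in the
  orthonormal basis of point masses. They vanish at both ends, for \<open>x = N\<close> and
  \<open>x = - N - 1\<close>, so the values of \<open>kr_p\<close> outside the lattice never enter.\<close>

definition kr_jump :: "nat \<Rightarrow> int \<Rightarrow> real" where
  "kr_jump N x = sqrt ((real N - of_int x) * (real N + of_int x + 1)) / 2"

text \<open>The eigenvalue equation, multiplied by the square root of the weight. The Pearson equation
  moves that factor to the neighbouring points.\<close>

lemma kr_p_recurrence:
  assumes m: "m \<le> 2 * N" and x: "x \<in> kr_space N"
  shows "(real N - real m) * kr_p N m x =
    kr_jump N x * kr_p N m (x + 1) + kr_jump N (x - 1) * kr_p N m (x - 1)"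
proof -
  let ?P = "monic_orthogonal_poly (kr_space N) (kr_weight N) m"
  let ?h = "orthogonal_poly_norm (kr_space N) (kr_weight N) m"
  let ?s = "\<lambda>x. sqrt (kr_weight N x)"
  have up: "(real N - of_int x) * ?s x = 2 * kr_jump N x * ?s (x + 1)"
    if "x \<in> kr_space N" for x
  proof -
    have nonneg: "real N - of_int x \<ge> 0" using that by (auto simp: kr_space_def)
    have "(real N - of_int x) * ?s x = sqrt (real N - of_int x) * sqrt ((real N - of_int x) * kr_weight N x)"
      using nonneg by (simp add: real_sqrt_mult)
    also have "\<dots> = 2 * kr_jump N x * ?s (x + 1)"
      by (subst kr_weight_pearson[OF that]) (simp add: real_sqrt_mult kr_jump_def)
    finally show ?thesis .
  qed
  have down: "(real N + of_int x) * ?s x = 2 * kr_jump N (x - 1) * ?s (x - 1)"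
  proof (cases "x = - int N")
    case True
    then show ?thesis by (simp add: kr_jump_def)
  next
    case False
    then have x': "x - 1 \<in> kr_space N" using x by (auto simp: kr_space_def)
    have nonneg: "real N + of_int x \<ge> 0" using x by (auto simp: kr_space_def)
    have "(real N + of_int x) * ?s x = sqrt (real N + of_int x) * sqrt ((real N + of_int x) * kr_weight N x)"
      using nonneg by (simp add: real_sqrt_mult)
    also have "(real N + of_int x) * kr_weight N x = (real N - of_int (x - 1)) * kr_weight N (x - 1)"
      using kr_weight_pearson[OF x'] by simp
    also have "sqrt (real N + of_int x) * sqrt \<dots> = 2 * kr_jump N (x - 1) * ?s (x - 1)"
      by (simp add: real_sqrt_mult kr_jump_def)
    finally show ?thesis .
  qed
  have scale: "u = (a * p + b * q) / 2 \<Longrightarrow> u * s = (p * (a * s) + q * (b * s)) / 2"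
    for u a b p q s :: real
    by (simp add: algebra_simps)
  have "(real N - real m) * poly ?P (of_int x) =
      ((real N - of_int x) * poly ?P (of_int x + 1) + (real N + of_int x) * poly ?P (of_int x - 1)) / 2"
    using kr_operator_eigen[OF is_monic_orthogonal_kr[OF m] m] poly_kr_operator[of N ?P "of_int x"]
    by simp
  then have "(real N - real m) * poly ?P (of_int x) * ?s x =
      (poly ?P (of_int x + 1) * ((real N - of_int x) * ?s x)
       + poly ?P (of_int x - 1) * ((real N + of_int x) * ?s x)) / 2"
    by (rule scale)
  also have "\<dots> = poly ?P (of_int x + 1) * (kr_jump N x * ?s (x + 1))
      + poly ?P (of_int x - 1) * (kr_jump N (x - 1) * ?s (x - 1))"
    unfolding up[OF x] down by simp
  finally show ?thesis
    by (simp add: kr_p_def add_divide_distrib[symmetric] mult_ac)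
qed

section \<open>Parity\<close>

text \<open>The polynomial \<open>(- 1) ^ m * P (- x)\<close> is again monic and orthogonal for a symmetric
  weight, so it is \<open>P\<close> by uniqueness.\<close>

lemma monic_orthogonal_parity:
  assumes ex1: "\<exists>!P. is_monic_orthogonal X w m P" and P: "is_monic_orthogonal X w m P"
    and sym: "\<And>x. x \<in> X \<Longrightarrow> - x \<in> X" "\<And>x. x \<in> X \<Longrightarrow> w (- x) = w x"
  shows "poly P (- t) = (- 1) ^ m * poly P t"
proof -
  define refl where "refl Q = pcompose Q [:0, - 1 :: real:]" for Q
  have refl [simp]: "poly (refl Q) u = poly Q (- u)" "degree (refl Q) = degree Q" for Q u
    by (simp_all add: refl_def poly_pcompose degree_pcompose)
  have inner: "weighted_inner X w (refl P) Q = weighted_inner X w P (refl Q)" for Q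
    unfolding weighted_inner_def
    by (rule sum.reindex_bij_witness[of _ uminus uminus]) (auto simp: sym)
  have lc: "lead_coeff (refl P) = (- 1) ^ m"
    using P unfolding refl_def is_monic_orthogonal_def by (subst lead_coeff_comp) auto
  have "is_monic_orthogonal X w m (smult ((- 1) ^ m) (refl P))"
    using P lc unfolding is_monic_orthogonal_def
    by (auto simp: weighted_inner_smult_left inner power_add[symmetric] mult_2[symmetric])
  then have "P = smult ((- 1) ^ m) (refl P)" using ex1 P by blast
  then have "poly P t = (- 1) ^ m * poly P (- t)" by (metis poly_smult refl(1))
  then show ?thesis by (simp add: mult.assoc[symmetric] power_add[symmetric] mult_2[symmetric])
qed

text \<open>Splitting a test polynomial as \<open>a + x * R\<close>, the product with \<open>x * P\<close> is \<open>a\<close> times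
  the integral of an odd function plus the product of \<open>P\<close> and \<open>R\<close> in the weight
  \<open>x\<^sup>2 * w\<close>.\<close>

lemma monic_orthogonal_times_x:
  assumes ex1: "\<exists>!P. is_monic_orthogonal X (\<lambda>x. (of_int x)\<^sup>2 * w x) m P"
    and P: "is_monic_orthogonal X (\<lambda>x. (of_int x)\<^sup>2 * w x) m P"
    and sym: "\<And>x. x \<in> X \<Longrightarrow> - x \<in> X" "\<And>x. x \<in> X \<Longrightarrow> w (- x) = w x"
    and "even m"
  shows "is_monic_orthogonal X w (Suc m) (pCons 0 P)"
proof -
  have even: "poly P (- t) = poly P t" for t
    using monic_orthogonal_parity[OF ex1 P sym(1)] sym(2) \<open>even m\<close> by simp
  have "P \<noteq> 0" using P by (auto simp: is_monic_orthogonal_def)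
  have "weighted_inner X w (pCons 0 P) Q = 0" if Q: "degree Q < Suc m" for Q
  proof -
    obtain a R where QR: "Q = pCons a R" by (cases Q)
    have "weighted_inner X w (pCons 0 P) Q = a * (\<Sum>x\<in>X. of_int x * poly P (of_int x) * w x)
        + weighted_inner X (\<lambda>x. (of_int x)\<^sup>2 * w x) P R"
      unfolding weighted_inner_def QR
      by (simp add: sum_distrib_left sum.distrib[symmetric] power2_eq_square algebra_simps)
    also have "(\<Sum>x\<in>X. of_int x * poly P (of_int x) * w x) = 0"
    proof -
      have "(\<Sum>x\<in>X. of_int x * poly P (of_int x) * w x) =
            (\<Sum>x\<in>X. - (of_int x * poly P (of_int x) * w x))"
        by (rule sum.reindex_bij_witness[of _ uminus uminus]) (auto simp: sym even)
      then show ?thesis by (simp add: sum_negf)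
    qed
    also have "weighted_inner X (\<lambda>x. (of_int x)\<^sup>2 * w x) P R = 0"
    proof (cases "R = 0")
      case False
      then have "degree R < m" using Q QR by simp
      then show ?thesis using P by (auto simp: is_monic_orthogonal_def)
    qed (simp add: weighted_inner_def)
    finally show ?thesis by simp
  qed
  then show ?thesis using P \<open>P \<noteq> 0\<close> by (auto simp: is_monic_orthogonal_def)
qed

lemma kr_p_parity:
  assumes "m \<le> 2 * N" "x \<in> kr_space N"
  shows "kr_p N m (- x) = (- 1) ^ m * kr_p N m x"
proof -
  let ?P = "monic_orthogonal_poly (kr_space N) (kr_weight N) m"
  have "poly ?P (- t) = (- 1) ^ m * poly ?P t" for t
    by (rule monic_orthogonal_parity[OF ex1_is_monic_orthogonal_kr is_monic_orthogonal_kr])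
       (use assms in \<open>auto simp: kr_space_def kr_weight_reflect\<close>)
  then show ?thesis
    using kr_weight_reflect[OF assms(2)] by (simp add: kr_p_def)
qed

lemma kr_p_hat_eq:
  assumes "l < N"
  shows "kr_p_hat N (2 * l) x = kr_p N (Suc (2 * l)) x"
proof -
  let ?P = "monic_orthogonal_poly (kr_space N) (kr_weight N) (Suc (2 * l))"
  let ?Q = "monic_orthogonal_poly (kr_space N) (kr_weight_hat N) (2 * l)"
  have hat: "kr_weight_hat N = (\<lambda>x. (of_int x)\<^sup>2 * kr_weight N x)"
    by (simp add: kr_weight_hat_def fun_eq_iff)
  have l: "2 * l \<le> 2 * N - 1" "Suc (2 * l) \<le> 2 * N" using assms by auto
  have "is_monic_orthogonal (kr_space N) (kr_weight N) (Suc (2 * l)) (pCons 0 ?Q)"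
    using ex1_is_monic_orthogonal_kr_hat[OF l(1)] is_monic_orthogonal_kr_hat[OF l(1)]
    unfolding hat
    by (rule monic_orthogonal_times_x) (auto simp: kr_space_def kr_weight_reflect)
  then have P: "?P = pCons 0 ?Q"
    using ex1_is_monic_orthogonal_kr[OF l(2)] is_monic_orthogonal_kr[OF l(2)] by blast
  have "orthogonal_poly_norm (kr_space N) (kr_weight N) (Suc (2 * l)) =
        orthogonal_poly_norm (kr_space N) (kr_weight_hat N) (2 * l)"
    unfolding orthogonal_poly_norm_def P
    by (simp add: weighted_inner_def kr_weight_hat_def power2_eq_square mult_ac)
  then show ?thesis unfolding kr_p_def kr_p_hat_def P by simp
qed

section \<open>The kernels as reflections of the Christoffel-Darboux kernel\<close>

definition kr_kernel :: "nat \<Rightarrow> nat \<Rightarrow> int \<Rightarrow> int \<Rightarrow> real" where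
  "kr_kernel N M x y = (\<Sum>m<M. kr_p N m x * kr_p N m y)"

lemma sum_even_odd_split: "(\<Sum>m<2*n. g m) = (\<Sum>l<n. g (2 * l) + g (Suc (2 * l)))" for g :: "nat \<Rightarrow> real"
  by (induction n) auto

text \<open>By parity, adding the reflected kernel doubles the terms of even degree and cancels those
  of odd degree; subtracting it does the opposite.\<close>

lemma kr_kernel0_eq:
  assumes "n \<le> N" "x \<in> kr_space N"
  shows "kr_kernel0 N n x y = eta x * eta y * (kr_kernel N (2 * n) x y + kr_kernel N (2 * n) (- x) y)"
proof -
  have "kr_kernel N (2 * n) x y + kr_kernel N (2 * n) (- x) y =
      (\<Sum>l<n. 2 * (kr_p N (2 * l) x * kr_p N (2 * l) y))"
    unfolding kr_kernel_def sum_even_odd_split sum.distrib[symmetric]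
    by (rule sum.cong) (use assms in \<open>auto simp: kr_p_parity\<close>)
  then show ?thesis by (simp add: kr_kernel0_def sum_distrib_left[symmetric])
qed

lemma kr_kernel1_eq:
  assumes "n \<le> N" "x \<in> kr_space N"
  shows "kr_kernel1 N n x y = kr_kernel N (2 * n) x y - kr_kernel N (2 * n) (- x) y"
proof -
  have "kr_kernel N (2 * n) x y - kr_kernel N (2 * n) (- x) y =
      (\<Sum>l<n. 2 * (kr_p_hat N (2 * l) x * kr_p_hat N (2 * l) y))"
    unfolding kr_kernel_def sum_even_odd_split sum_subtractf[symmetric]
    by (rule sum.cong) (use assms in \<open>auto simp: kr_p_parity kr_p_hat_eq\<close>)
  then show ?thesis by (simp add: kr_kernel1_def sum_distrib_left[symmetric])
qed

section \<open>Convergence of the spectral measures\<close>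

lemma has_integral_cos_mult:
  fixes j b :: real
  assumes "j \<noteq> 0" "0 \<le> b"
  shows "((\<lambda>t. cos (j * t)) has_integral sin (j * b) / j) {0..b}"
proof -
  have "((\<lambda>t. cos (j * t)) has_integral sin (j * b) / j - sin (j * 0) / j) {0..b}"
    by (rule fundamental_theorem_of_calculus)
       (use assms in \<open>auto intro!: derivative_eq_intros
          simp: has_real_derivative_iff_has_vector_derivative[symmetric]\<close>)
  then show ?thesis by simp
qed

lemma sine_kernel_eq_integral:
  assumes "0 \<le> \<phi>"
  shows "sine_kernel \<phi> A B = integral {0..\<phi>} (\<lambda>t. cos (of_int (A - B) * t)) / pi"
proof (cases "A = B")
  case True
  then show ?thesis using assms by (simp add: sine_kernel_def)
next
  case False
  then have "real_of_int (A - B) \<noteq> 0" by simp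
  from integral_unique[OF has_integral_cos_mult[OF this assms]]
  show ?thesis using False by (simp add: sine_kernel_def mult.commute)
qed

text \<open>As functions of \<open>x\<close>, the moments of order \<open>k\<close> arise from the point mass at \<open>y\<close> by
  \<open>k\<close> applications of the Jacobi matrix divided by \<open>N\<close>. Near any fixed \<open>x\<close> its entries
  tend to \<open>1 / 2\<close>, so the limits satisfy
  \<open>c (k + 1) x = (c k (x + 1) + c k (x - 1)) / 2\<close>, which the cosine integrals satisfy by the
  addition theorem.\<close>

lemma kr_moment_limit:
  "(\<lambda>N. \<Sum>m\<le>2*N. (1 - real m / real N) ^ k * kr_p N m x * kr_p N m y)
     \<longlonglongrightarrow> integral {0..pi} (\<lambda>t. cos t ^ k * cos (of_int (x - y) * t)) / pi"
proof (induction k arbitrary: x)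
  case 0
  have "eventually (\<lambda>N. (\<Sum>m\<le>2*N. (1 - real m / real N) ^ 0 * kr_p N m x * kr_p N m y)
      = of_bool (x = y)) sequentially"
    using eventually_ge_at_top[of "max (nat \<bar>x\<bar>) (nat \<bar>y\<bar>)"]
  proof eventually_elim
    case (elim N)
    then have "x \<in> kr_space N" "y \<in> kr_space N" by (auto simp: kr_space_def)
    then show ?case using kr_p_complete by simp
  qed
  then have "(\<lambda>N. \<Sum>m\<le>2*N. (1 - real m / real N) ^ 0 * kr_p N m x * kr_p N m y) \<longlonglongrightarrow> of_bool (x = y)"
    by (rule tendsto_eventually)
  also have "of_bool (x = y) = sine_kernel pi x y"
  proof -
    have "sin (pi * real_of_int (x - y)) = 0"
      by (metis mult.commute sin_integer_2pi sin_zero_iff_int2)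
    then show ?thesis by (simp add: sine_kernel_def)
  qed
  also have "\<dots> = integral {0..pi} (\<lambda>t. cos t ^ 0 * cos (of_int (x - y) * t)) / pi"
    by (simp add: sine_kernel_eq_integral)
  finally show ?case .
next
  case (Suc k)
  define M where "M N k x = (\<Sum>m\<le>2*N. (1 - real m / real N) ^ k * kr_p N m x * kr_p N m y)" for N k x
  define c where "c k x = integral {0..pi} (\<lambda>t. cos t ^ k * cos (of_int (x - y) * t)) / pi" for k x
  have IH: "(\<lambda>N. M N k x) \<longlonglongrightarrow> c k x" for x using Suc.IH by (simp add: M_def c_def)
  have jump: "(\<lambda>N. kr_jump N x / real N) \<longlonglongrightarrow> 1 / 2" for x
  proof -
    have "(\<lambda>N. sqrt ((1 - of_int x * inverse (real N)) * (1 + (of_int x + 1) * inverse (real N))) / 2)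
       \<longlonglongrightarrow> sqrt ((1 - of_int x * 0) * (1 + (of_int x + 1) * 0)) / 2"
      by (intro tendsto_intros lim_inverse_n) auto
    moreover have "eventually (\<lambda>N. sqrt ((1 - of_int x * inverse (real N)) * (1 + (of_int x + 1) * inverse (real N))) / 2
       = kr_jump N x / real N) sequentially"
      using eventually_gt_at_top[of 0]
    proof eventually_elim
      case (elim N)
      have "(1 - of_int x * inverse (real N)) * (1 + (of_int x + 1) * inverse (real N)) =
         ((real N - of_int x) * (real N + of_int x + 1)) / (real N)\<^sup>2"
        using elim by (simp add: field_simps power2_eq_square)
      then show ?case using elim by (simp add: kr_jump_def real_sqrt_divide)
    qed
    ultimately show ?thesis by (simp add: Lim_transform_eventually)
  qed
  have step_lim: "(\<lambda>N. kr_jump N x / real N * M N k (x + 1) + kr_jump N (x - 1) / real N * M N k (x - 1))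
      \<longlonglongrightarrow> 1 / 2 * c k (x + 1) + 1 / 2 * c k (x - 1)"
    by (intro tendsto_intros jump IH)
  have step_eq: "eventually (\<lambda>N. kr_jump N x / real N * M N k (x + 1)
      + kr_jump N (x - 1) / real N * M N k (x - 1) = M N (Suc k) x) sequentially"
    using eventually_ge_at_top[of "max 1 (nat \<bar>x\<bar>)"]
  proof eventually_elim
    case (elim N)
    then have x: "x \<in> kr_space N" and N: "N > 0" by (auto simp: kr_space_def)
    have "(1 - real m / real N) * kr_p N m x = kr_jump N x / real N * kr_p N m (x + 1)
       + kr_jump N (x - 1) / real N * kr_p N m (x - 1)" if "m \<le> 2 * N" for m
    proof -
      have "(1 - real m / real N) * kr_p N m x = ((real N - real m) * kr_p N m x) / real N"
        using N by (simp add: field_simps)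
      then show ?thesis using kr_p_recurrence[OF that x] by (simp add: add_divide_distrib)
    qed
    then have "M N (Suc k) x = (\<Sum>m\<le>2*N. (1 - real m / real N) ^ k *
       (kr_jump N x / real N * kr_p N m (x + 1)
       + kr_jump N (x - 1) / real N * kr_p N m (x - 1)) * kr_p N m y)"
      unfolding M_def by (intro sum.cong refl) (simp add: power_Suc2 mult.assoc del: power_Suc)
    then show ?case
      by (simp add: M_def sum_distrib_left sum.distrib[symmetric] algebra_simps)
  qed
  have mean: "1 / 2 * c k (x + 1) + 1 / 2 * c k (x - 1) = c (Suc k) x"
  proof -
    have "c k (x + 1) + c k (x - 1) = integral {0..pi} (\<lambda>t. cos t ^ k * cos (of_int (x + 1 - y) * t)
       + cos t ^ k * cos (of_int (x - 1 - y) * t)) / pi"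
      unfolding c_def
      by (subst integral_add)
         (auto intro!: integrable_continuous_interval continuous_intros simp: add_divide_distrib)
    also have "(\<lambda>t::real. cos t ^ k * cos (of_int (x + 1 - y) * t) + cos t ^ k * cos (of_int (x - 1 - y) * t))
       = (\<lambda>t. 2 * (cos t ^ Suc k * cos (of_int (x - y) * t)))"
    proof
      fix t :: real
      have "cos (of_int (x + 1 - y) * t) = cos (of_int (x - y) * t + t)"
           "cos (of_int (x - 1 - y) * t) = cos (of_int (x - y) * t - t)"
        by (simp_all add: algebra_simps)
      then show "cos t ^ k * cos (of_int (x + 1 - y) * t) + cos t ^ k * cos (of_int (x - 1 - y) * t)
       = 2 * (cos t ^ Suc k * cos (of_int (x - y) * t))"
        by (simp only: cos_add cos_diff) (simp add: algebra_simps)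
    qed
    finally show ?thesis by (simp add: c_def del: power_Suc)
  qed
  have "(\<lambda>N. M N (Suc k) x) \<longlonglongrightarrow> 1 / 2 * c k (x + 1) + 1 / 2 * c k (x - 1)"
    by (rule Lim_transform_eventually[OF step_lim step_eq])
  then have "(\<lambda>N. M N (Suc k) x) \<longlonglongrightarrow> c (Suc k) x" unfolding mean .
  then show ?case by (simp add: M_def c_def)
qed

lemma abs_mult_le_mean_squares: "\<bar>a * b\<bar> \<le> (a * a + b * b) / 2" for a b :: real
  using sum_squares_bound[of "\<bar>a\<bar>" "\<bar>b\<bar>"] by (simp add: abs_mult power2_eq_square)

text \<open>The total variation bound that carries the limit from polynomials to continuous test
  functions.\<close>

lemma kr_p_abs_sum_le:
  assumes "x \<in> kr_space N" "y \<in> kr_space N"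
  shows "(\<Sum>m\<le>2*N. \<bar>kr_p N m x * kr_p N m y\<bar>) \<le> 1"
proof -
  have "(\<Sum>m\<le>2*N. \<bar>kr_p N m x * kr_p N m y\<bar>)
     \<le> (\<Sum>m\<le>2*N. (kr_p N m x * kr_p N m x + kr_p N m y * kr_p N m y) / 2)"
    by (intro sum_mono abs_mult_le_mean_squares)
  also have "\<dots> = 1"
    using kr_p_complete[OF assms(1,1)] kr_p_complete[OF assms(2,2)]
    by (simp add: sum_divide_distrib[symmetric] sum.distrib)
  finally show ?thesis .
qed

lemma kr_eigenvalue_range:
  assumes "m \<le> 2 * N" shows "\<bar>1 - real m / real N\<bar> \<le> 1"
proof -
  have "real m \<le> 2 * real N" using assms by linarith
  then show ?thesis by (cases "N = 0") (auto simp: abs_le_iff field_simps)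
qed

text \<open>In the angles \<open>arccos (1 - m / N)\<close>, which exist as the rescaled eigenvalues lie in
  \<open>{-1..1}\<close>, the limit measure is the Lebesgue measure with a bounded density. The function
  \<open>F \<circ> arccos\<close> is approximated uniformly by polynomials on \<open>{-1..1}\<close>.\<close>

lemma kr_angle_limit:
  assumes F: "continuous_on {0..pi} F"
  shows "(\<lambda>N. \<Sum>m\<le>2*N. F (arccos (1 - real m / real N)) * (kr_p N m x * kr_p N m y))
     \<longlonglongrightarrow> integral {0..pi} (\<lambda>t. F t * cos (of_int (x - y) * t)) / pi"
    (is "?S \<longlonglongrightarrow> ?L")
proof (rule LIMSEQ_I)
  fix e :: real assume "e > 0"
  define d where "d = e / 3"
  have "d > 0" using \<open>e > 0\<close> by (simp add: d_def)
  have "continuous_on {-1..1} (\<lambda>u. F (arccos u))"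
    by (rule continuous_on_compose2[OF F]) (auto intro!: continuous_intros arccos_lbound arccos_ubound)
  then obtain g where g: "real_polynomial_function g" "\<And>u. u \<in> {-1..1} \<Longrightarrow> \<bar>F (arccos u) - g u\<bar> < d"
    using Stone_Weierstrass_real_polynomial_function[of "{-1..1}" "\<lambda>u. F (arccos u)" d] \<open>d > 0\<close>
    by blast
  obtain a K where gK: "g = (\<lambda>u. \<Sum>k\<le>K. a k * u ^ k)"
    using g(1) unfolding real_polynomial_function_iff_sum by blast
  define T where "T N = (\<Sum>m\<le>2*N. g (1 - real m / real N) * (kr_p N m x * kr_p N m y))" for N
  define I where "I = integral {0..pi} (\<lambda>t. g (cos t) * cos (of_int (x - y) * t)) / pi"
  have "T = (\<lambda>N. \<Sum>k\<le>K. a k * (\<Sum>m\<le>2*N. (1 - real m / real N) ^ k * kr_p N m x * kr_p N m y))"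
    unfolding T_def[abs_def] gK sum_distrib_right sum_distrib_left
    by (subst sum.swap) (simp add: mult_ac)
  moreover have "I = (\<Sum>k\<le>K. a k * (integral {0..pi} (\<lambda>t. cos t ^ k * cos (of_int (x - y) * t)) / pi))"
  proof -
    have "integral {0..pi} (\<lambda>t. g (cos t) * cos (of_int (x - y) * t)) =
       integral {0..pi} (\<lambda>t. \<Sum>k\<le>K. a k * (cos t ^ k * cos (of_int (x - y) * t)))"
      by (simp add: gK sum_distrib_right mult.assoc)
    also have "\<dots> = (\<Sum>k\<le>K. integral {0..pi} (\<lambda>t. a k * (cos t ^ k * cos (of_int (x - y) * t))))"
      by (rule integral_sum) (auto intro!: integrable_continuous_interval continuous_intros)
    finally show ?thesis by (simp add: I_def sum_divide_distrib)
  qed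
  moreover have "(\<lambda>N. \<Sum>k\<le>K. a k * (\<Sum>m\<le>2*N. (1 - real m / real N) ^ k * kr_p N m x * kr_p N m y))
     \<longlonglongrightarrow> (\<Sum>k\<le>K. a k * (integral {0..pi} (\<lambda>t. cos t ^ k * cos (of_int (x - y) * t)) / pi))"
    by (intro tendsto_intros kr_moment_limit)
  ultimately have "T \<longlonglongrightarrow> I" by simp
  then have T: "eventually (\<lambda>N. \<bar>T N - I\<bar> < d) sequentially"
    using \<open>d > 0\<close> unfolding tendsto_iff dist_real_def by blast
  have L: "\<bar>?L - I\<bar> \<le> d"
  proof -
    have cont_g: "continuous_on {0..pi} (\<lambda>t. g (cos t))"
      unfolding gK by (intro continuous_intros)
    have int: "(\<lambda>t. F t * cos (of_int (x - y) * t)) integrable_on {0..pi}"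
        "(\<lambda>t. g (cos t) * cos (of_int (x - y) * t)) integrable_on {0..pi}"
      by (auto intro!: integrable_continuous_interval continuous_intros F cont_g)
    have "\<bar>integral {0..pi} (\<lambda>t. F t * cos (of_int (x - y) * t)) -
          integral {0..pi} (\<lambda>t. g (cos t) * cos (of_int (x - y) * t))\<bar>
        = norm (integral {0..pi} (\<lambda>t. F t * cos (of_int (x - y) * t) - g (cos t) * cos (of_int (x - y) * t)))"
      using int by (simp add: integral_diff)
    also have "\<dots> \<le> integral {0..pi} (\<lambda>t. d)"
    proof (rule integral_norm_bound_integral)
      fix t assume t: "t \<in> {0..pi}"
      then have "\<bar>F t - g (cos t)\<bar> \<le> d" using g(2)[of "cos t"] by (simp add: arccos_cos)
      then have "\<bar>F t - g (cos t)\<bar> * \<bar>cos (of_int (x - y) * t)\<bar> \<le> d * 1"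
        by (intro mult_mono) auto
      then show "norm (F t * cos (of_int (x - y) * t) - g (cos t) * cos (of_int (x - y) * t)) \<le> d"
        by (simp add: abs_mult[symmetric] algebra_simps)
    qed (use int in \<open>auto intro!: integrable_diff\<close>)
    also have "\<dots> = d * pi" by simp
    finally show ?thesis by (simp add: I_def diff_divide_distrib[symmetric] field_simps)
  qed
  have "eventually (\<lambda>N. norm (?S N - ?L) < e) sequentially"
    using T eventually_ge_at_top[of "max (nat \<bar>x\<bar>) (nat \<bar>y\<bar>)"]
  proof eventually_elim
    case (elim N)
    then have xy: "x \<in> kr_space N" "y \<in> kr_space N" by (auto simp: kr_space_def)
    have "\<bar>?S N - T N\<bar> = \<bar>\<Sum>m\<le>2*N. (F (arccos (1 - real m / real N)) - g (1 - real m / real N))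
        * (kr_p N m x * kr_p N m y)\<bar>"
      by (simp add: T_def sum_subtractf[symmetric] left_diff_distrib)
    also have "\<dots> \<le> (\<Sum>m\<le>2*N. d * \<bar>kr_p N m x * kr_p N m y\<bar>)"
    proof (rule order_trans[OF sum_abs], rule sum_mono)
      fix m assume "m \<in> {..2*N}"
      then have "1 - real m / real N \<in> {-1..1}" using kr_eigenvalue_range[of m N] by (auto simp: abs_le_iff)
      from g(2)[OF this] show "\<bar>(F (arccos (1 - real m / real N)) - g (1 - real m / real N))
        * (kr_p N m x * kr_p N m y)\<bar> \<le> d * \<bar>kr_p N m x * kr_p N m y\<bar>"
        unfolding abs_mult[of "F _ - _"] by (intro mult_right_mono) auto
    qed
    also have "\<dots> \<le> d"
      using mult_left_mono[OF kr_p_abs_sum_le[OF xy], of d] \<open>d > 0\<close> by (simp add: sum_distrib_left)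
    finally show ?case using elim(1) L unfolding d_def real_norm_def by linarith
  qed
  then show "\<exists>no. \<forall>N\<ge>no. norm (?S N - ?L) < e" unfolding eventually_sequentially .
qed

section \<open>The limit of the Christoffel-Darboux kernel\<close>

text \<open>The kernel is the measure of the angles below \<open>arccos (1 - 2 * n / N)\<close>, a threshold that
  moves with \<open>N\<close> and tends to \<open>\<phi>\<close>. A continuous ramp \<open>F\<close> replaces the indicator at the cost of
  a bump \<open>G\<close> of integral at most \<open>4 * d\<close> around \<open>\<phi>\<close>. The weights may have either sign if
  \<open>x\<close> and \<open>y\<close> differ, so the error is estimated through the positive measures at
  \<open>(x, x)\<close> and \<open>(y, y)\<close>.\<close>

lemma kr_kernel_limit:
  fixes n :: "nat \<Rightarrow> nat"
  assumes "0 < \<gamma>" "\<gamma> < 1" and lim: "(\<lambda>N. real (n N) / real N) \<longlonglongrightarrow> \<gamma>"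
    and \<phi>: "\<phi> = arccos (1 - 2 * \<gamma>)"
  shows "(\<lambda>N. kr_kernel N (2 * n N) x y) \<longlonglongrightarrow> sine_kernel \<phi> x y"
proof (rule LIMSEQ_I)
  fix e :: real assume "e > 0"
  \<comment> \<open>Five equal parts: two for the ramp in the sum, two for the ramp in the integral, one for
    the convergence with the ramp as test function.\<close>
  define d where "d = e / 5"
  have "d > 0" using \<open>e > 0\<close> by (simp add: d_def)
  have \<phi>_range: "0 \<le> \<phi>" "\<phi> \<le> pi"
    using assms unfolding \<phi> by (auto intro!: arccos_lbound arccos_ubound)
  define F where "F t = max 0 (min 1 ((\<phi> + d - t) / (2 * d)))" for t
  define G where "G t = max 0 (min 1 (2 - \<bar>t - \<phi>\<bar> / d))" for t
  \<comment> \<open>Only the value of the indicator at distance more than \<open>d\<close> from \<open>\<phi>\<close> matters, so one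
    estimate serves both the moving threshold and its limit.\<close>
  have FG: "\<bar>of_bool P - F t\<bar> \<le> G t"
    if "t < \<phi> - d \<Longrightarrow> P" "t > \<phi> + d \<Longrightarrow> \<not> P" for t P
  proof -
    have F01: "0 \<le> F t" "F t \<le> 1" by (auto simp: F_def)
    consider "t < \<phi> - d" | "t > \<phi> + d" | "\<bar>t - \<phi>\<bar> \<le> d" by linarith
    then show ?thesis
    proof cases
      case 1
      then have "F t = 1" using \<open>d > 0\<close> by (simp add: F_def field_simps)
      then show ?thesis using 1 that by (simp add: G_def)
    next
      case 2
      then have "F t = 0" using \<open>d > 0\<close> by (simp add: F_def field_simps max_def)
      then show ?thesis using 2 that by (simp add: G_def)
    next
      case 3
      then have "G t = 1" using \<open>d > 0\<close> by (simp add: G_def field_simps)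
      then show ?thesis using F01 by (cases P) auto
    qed
  qed
  have contF: "continuous_on S F" and contG: "continuous_on S G" for S
    unfolding F_def G_def by (use \<open>d > 0\<close> in \<open>auto intro!: continuous_intros\<close>)
  have G_nonneg: "G t \<ge> 0" for t by (simp add: G_def)
  have G_int: "integral {0..pi} G \<le> 4 * d"
  proof -
    let ?J = "{\<phi> - 2 * d..\<phi> + 2 * d}"
    have intG: "G integrable_on {a..b}" for a b
      by (intro integrable_continuous_interval contG)
    have "(\<lambda>t. if t \<in> ?J then G t else 0) = G"
    proof
      fix t
      have "G t = 0" if "t \<notin> ?J"
      proof -
        have "\<bar>t - \<phi>\<bar> > 2 * d" using that by auto
        then show ?thesis using \<open>d > 0\<close> by (simp add: G_def field_simps max_def)
      qed
      then show "(if t \<in> ?J then G t else 0) = G t" by auto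
    qed
    then have "integral {0..pi} G = integral (?J \<inter> {0..pi}) G"
      using integral_restrict_Int[of "{0..pi}" ?J G] by simp
    also have "\<dots> \<le> integral ?J G"
      by (rule integral_subset_le) (use intG G_nonneg in \<open>auto simp: Int_atLeastAtMost\<close>)
    also have "\<dots> \<le> integral ?J (\<lambda>_. 1)"
      by (rule integral_le) (use intG in \<open>auto simp: G_def\<close>)
    also have "\<dots> = 4 * d" using \<open>d > 0\<close> by simp
    finally show ?thesis .
  qed
  define \<theta> where "\<theta> N m = arccos (1 - real m / real N)" for N m
  define S where "S H x y N = (\<Sum>m\<le>2*N. H (\<theta> N m) * (kr_p N m x * kr_p N m y))" for H x y N
  define I where "I H x y = integral {0..pi} (\<lambda>t. H t * cos (of_int (x - y) * t)) / pi" for H and x y :: int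
  have S: "S H x y \<longlonglongrightarrow> I H x y" if "continuous_on {0..pi} H" for H x y
    using kr_angle_limit[OF that, of x y] unfolding S_def[abs_def] I_def \<theta>_def .
  have IG: "I G z z < 2 * d" for z
  proof -
    have "I G z z \<le> 4 * d / pi" unfolding I_def using G_int by (simp add: divide_right_mono)
    also have "\<dots> < 2 * d" using pi_gt3 \<open>d > 0\<close> by (simp add: field_simps)
    finally show ?thesis .
  qed
  have sk: "\<bar>sine_kernel \<phi> x y - I F x y\<bar> < 2 * d"
  proof -
    let ?c = "\<lambda>t. cos (of_int (x - y) * t)"
    have eq: "(\<lambda>t. of_bool (t \<le> \<phi>) * ?c t) = (\<lambda>t. if t \<in> {..\<phi>} then ?c t else 0)"
      by (auto simp: fun_eq_iff)
    have J: "{..\<phi>} \<inter> {0..pi} = {0..\<phi>}" using \<phi>_range by auto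
    have int1: "(\<lambda>t. of_bool (t \<le> \<phi>) * ?c t) integrable_on {0..pi}"
      unfolding eq integrable_restrict_Int J
      by (intro integrable_continuous_interval continuous_intros)
    have int2: "(\<lambda>t. F t * ?c t) integrable_on {0..pi}"
      by (intro integrable_continuous_interval continuous_intros contF)
    have "sine_kernel \<phi> x y = integral {0..pi} (\<lambda>t. of_bool (t \<le> \<phi>) * ?c t) / pi"
      unfolding eq integral_restrict_Int J sine_kernel_eq_integral[OF \<phi>_range(1)] by simp
    then have "\<bar>sine_kernel \<phi> x y - I F x y\<bar> =
       norm (integral {0..pi} (\<lambda>t. of_bool (t \<le> \<phi>) * ?c t - F t * ?c t)) / pi"
      using int1 int2 by (simp add: I_def integral_diff diff_divide_distrib[symmetric])
    also have "\<dots> \<le> integral {0..pi} G / pi"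
    proof (intro divide_right_mono integral_norm_bound_integral integrable_diff int1 int2)
      fix t
      have "\<bar>of_bool (t \<le> \<phi>) - F t\<bar> * \<bar>?c t\<bar> \<le> G t * 1"
        using \<open>d > 0\<close> G_nonneg by (intro mult_mono FG) auto
      then show "norm (of_bool (t \<le> \<phi>) * ?c t - F t * ?c t) \<le> G t"
        by (simp only: left_diff_distrib[symmetric] real_norm_def abs_mult mult_1_right)
    qed (auto intro!: integrable_continuous_interval contG)
    also have "\<dots> < 2 * d" using IG[of 0] by (simp add: I_def)
    finally show ?thesis .
  qed
  have "(\<lambda>N. 1 - 2 * (real (n N) / real N)) \<longlonglongrightarrow> 1 - 2 * \<gamma>"
    by (intro tendsto_intros lim)
  moreover have "isCont arccos (1 - 2 * \<gamma>)"
    using assms by (intro isCont_arccos) auto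
  ultimately have "(\<lambda>N. arccos (1 - 2 * (real (n N) / real N))) \<longlonglongrightarrow> \<phi>"
    unfolding \<phi> using isCont_tendsto_compose by blast
  then have "eventually (\<lambda>N. \<bar>arccos (1 - 2 * (real (n N) / real N)) - \<phi>\<bar> < d) sequentially"
    using \<open>d > 0\<close> unfolding tendsto_iff dist_real_def by blast
  moreover have "eventually (\<lambda>N. real (n N) / real N < 1) sequentially"
    using order_tendstoD(2)[OF lim \<open>\<gamma> < 1\<close>] .
  moreover have "eventually (\<lambda>N. \<bar>S F x y N - I F x y\<bar> < d) sequentially"
    using S[OF contF, of x y] \<open>d > 0\<close> unfolding tendsto_iff dist_real_def by blast
  moreover have "eventually (\<lambda>N. S G x x N < 2 * d) sequentially"
      "eventually (\<lambda>N. S G y y N < 2 * d) sequentially"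
    using order_tendstoD(2)[OF S[OF contG] IG] by blast+
  ultimately have "eventually (\<lambda>N. norm (kr_kernel N (2 * n N) x y - sine_kernel \<phi> x y) < e) sequentially"
    using eventually_gt_at_top[of 0]
  proof eventually_elim
    case (elim N)
    have nN: "n N < N" using elim(2,6) by (simp add: field_simps)
    have idx: "m < 2 * n N \<longleftrightarrow> \<theta> N m < arccos (1 - 2 * (real (n N) / real N))" if "m \<le> 2 * N" for m
    proof -
      have "\<bar>1 - 2 * (real (n N) / real N)\<bar> \<le> 1"
        using kr_eigenvalue_range[of "2 * n N" N] nN by simp
      then have "\<theta> N m < arccos (1 - 2 * (real (n N) / real N)) \<longleftrightarrow>
          real m / real N < real (2 * n N) / real N"
        unfolding \<theta>_def using kr_eigenvalue_range[OF that] by (simp add: arccos_less_mono)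
      also have "\<dots> \<longleftrightarrow> m < 2 * n N"
        using elim(6) by (simp add: divide_less_cancel del: of_nat_mult)
      finally show ?thesis by simp
    qed
    have "kr_kernel N (2 * n N) x y = (\<Sum>m\<le>2*N. of_bool (m < 2 * n N) * (kr_p N m x * kr_p N m y))"
      unfolding kr_kernel_def
      by (rule sum.mono_neutral_cong_left) (use nN in auto)
    then have "\<bar>kr_kernel N (2 * n N) x y - S F x y N\<bar> =
       \<bar>\<Sum>m\<le>2*N. (of_bool (m < 2 * n N) - F (\<theta> N m)) * (kr_p N m x * kr_p N m y)\<bar>"
      by (simp only: S_def sum_subtractf[symmetric] left_diff_distrib)
    also have "\<dots> \<le> (\<Sum>m\<le>2*N. G (\<theta> N m) * ((kr_p N m x * kr_p N m x + kr_p N m y * kr_p N m y) / 2))"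
    proof (rule order_trans[OF sum_abs], rule sum_mono)
      fix m assume m: "m \<in> {..2*N}"
      have "\<bar>of_bool (m < 2 * n N) - F (\<theta> N m)\<bar> \<le> G (\<theta> N m)"
        using elim(1) m idx by (intro FG) auto
      then show "\<bar>(of_bool (m < 2 * n N) - F (\<theta> N m)) * (kr_p N m x * kr_p N m y)\<bar> \<le>
         G (\<theta> N m) * ((kr_p N m x * kr_p N m x + kr_p N m y * kr_p N m y) / 2)"
        unfolding abs_mult[of "_ - _"] using G_nonneg
        by (intro mult_mono abs_mult_le_mean_squares) auto
    qed
    also have "\<dots> = (S G x x N + S G y y N) / 2"
      by (simp add: S_def sum.distrib[symmetric] sum_divide_distrib distrib_left add_divide_distrib)
    also have "\<dots> < 2 * d"
    proof -
      have "S G x x N + S G y y N < 2 * d + 2 * d" by (rule add_strict_mono[OF elim(4,5)])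
      then show ?thesis by simp
    qed
    finally have "\<bar>kr_kernel N (2 * n N) x y - S F x y N\<bar> < 2 * d" .
    then have "\<bar>kr_kernel N (2 * n N) x y - sine_kernel \<phi> x y\<bar> < 5 * d"
      using elim(3) sk by linarith
    then show ?case by (simp add: d_def)
  qed
  then show "\<exists>no. \<forall>N\<ge>no. norm (kr_kernel N (2 * n N) x y - sine_kernel \<phi> x y) < e"
    unfolding eventually_sequentially .
qed

theorem proposition4p6:
  fixes n :: "nat \<Rightarrow> nat" and \<gamma> \<phi> :: real and A B :: int
  assumes "\<And>N. N > 0 \<Longrightarrow> n N > 0"
    and "0 < \<gamma>" and "\<gamma> < 1"
    and "(\<lambda>N. real (n N) / real N) \<longlonglongrightarrow> \<gamma>"
    and "\<phi> = arccos (1 - 2 * \<gamma>)"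
  shows "((\<lambda>N. kr_kernel0 N (n N) A B) \<longlonglongrightarrow>
             eta A * eta B * (sine_kernel \<phi> A B + sine_kernel \<phi> (- A) B))
       \<and> ((\<lambda>N. kr_kernel1 N (n N) A B) \<longlonglongrightarrow>
             sine_kernel \<phi> A B - sine_kernel \<phi> (- A) B)"
proof
  note lim = kr_kernel_limit[OF assms(2-5)]
  have ev: "eventually (\<lambda>N. n N \<le> N \<and> A \<in> kr_space N) sequentially"
    using order_tendstoD(2)[OF assms(4,3)] eventually_ge_at_top[of "max 1 (nat \<bar>A\<bar>)"]
    by eventually_elim (auto simp: kr_space_def field_simps)
  have "(\<lambda>N. eta A * eta B * (kr_kernel N (2 * n N) A B + kr_kernel N (2 * n N) (- A) B)) \<longlonglongrightarrow>
             eta A * eta B * (sine_kernel \<phi> A B + sine_kernel \<phi> (- A) B)"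
    by (intro tendsto_intros lim)
  moreover have "eventually (\<lambda>N. eta A * eta B * (kr_kernel N (2 * n N) A B
      + kr_kernel N (2 * n N) (- A) B) = kr_kernel0 N (n N) A B) sequentially"
    using ev by eventually_elim (simp add: kr_kernel0_eq)
  ultimately show "(\<lambda>N. kr_kernel0 N (n N) A B) \<longlonglongrightarrow>
             eta A * eta B * (sine_kernel \<phi> A B + sine_kernel \<phi> (- A) B)"
    by (rule Lim_transform_eventually)
  have "(\<lambda>N. kr_kernel N (2 * n N) A B - kr_kernel N (2 * n N) (- A) B) \<longlonglongrightarrow>
             sine_kernel \<phi> A B - sine_kernel \<phi> (- A) B"
    by (intro tendsto_intros lim)
  moreover have "eventually (\<lambda>N. kr_kernel N (2 * n N) A B
      - kr_kernel N (2 * n N) (- A) B = kr_kernel1 N (n N) A B) sequentially"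
    using ev by eventually_elim (simp add: kr_kernel1_eq)
  ultimately show "(\<lambda>N. kr_kernel1 N (n N) A B) \<longlonglongrightarrow>
             sine_kernel \<phi> A B - sine_kernel \<phi> (- A) B"
    by (rule Lim_transform_eventually)
qed

end
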